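(* Let $d\in\mathbb{N}$, let $\Omega\subset\mathbb{C}^d$ be a nonempty open set, and let $\mathcal{X}\subset\operatorname{Hol}(\Omega)$ be a Hausdorff topological vector space satisfying properties P1, P2, P3 (see context). For $w\in\mathbb{C}^d$ let $\mathcal{F}_w:=\{z_j-w_j:1\le j\le d\}\subset\mathcal{P}_d$. Then for all $w\in\mathbb{C}^d$, $$\mathcal{X}=\mathbb{C}1+S[\mathcal{F}_w],$$ where $\mathbb{C}1$ is the space of constant functions. Moreover, for each $w\in\mathbb{C}^d$ the following are equivalent: (1) $w\in\Omega_{max}$. (2) $\mathcal{F}_w$ is not jointly cyclic. (3) $\mathcal{X}=\mathbb{C}1\oplus S[\mathcal{F}_w]$ as an algebraic direct sum.
   Context: All vector spaces are over $\mathbb{C}$; topological vector spaces are not assumed locally convex. $\operatorname{Hol}(\Omega)$ is the space of holomorphic functions on $\Omega$. $\mathcal{P}_d$ is the set of polynomials in $d$ complex variables, viewed (by restriction) as functions on $\Omega$. The properties are: P1: $\mathcal{P}_d\subset\mathcal{X}$ and $\mathcal{P}_d$ is dense in $\mathcal{X}$. P2: for each $w\in\Omega$ the evaluation functional $\Lambda_w(F)=F(w)$, $F\in\mathcal{X}$, is continuous. P3: for each $1\le j\le d$ the shift operator $S_jF(z)=z_jF(z)$ maps $\mathcal{X}$ to $\mathcal{X}$ and is continuous. For $F\in\mathcal{X}$, $S[F]:=\overline{\{PF:P\in\mathcal{P}_d\}}$ (closure in $\mathcal{X}$). For a family $\mathcal{F}\subset\mathcal{X}$, $S[\mathcal{F}]$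 is the closed linear span in $\mathcal{X}$ of $\bigcup_{F\in\mathcal{F}}S[F]$; $\mathcal{F}$ is jointly cyclic if $S[\mathcal{F}]=\mathcal{X}$. Maximal domain: $\Omega_{max}$ is the set of all $w\in\mathbb{C}^d$ such that the functional $P\mapsto P(w)$ on $\mathcal{P}_d$ extends to a continuous linear functional on $\mathcal{X}$. *)

theory Defs
  imports "HOL-Analysis.Analysis" "HOL-Library.Function_Algebras" "HOL-Library.Set_Algebras"
begin

text \<open>A function on \<open>\<Omega>\<close> is encoded as a total function that vanishes off \<open>\<Omega>\<close>; the vector space
  operations are then the pointwise ones on total functions.\<close>

definition restr :: "'a set \<Rightarrow> ('a \<Rightarrow> complex) \<Rightarrow> 'a \<Rightarrow> complex" where
  "restr \<Omega> f = (\<lambda>z. if z \<in> \<Omega> then f z else 0)"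

definition cscale :: "complex \<Rightarrow> ('a \<Rightarrow> complex) \<Rightarrow> 'a \<Rightarrow> complex" where
  "cscale c f = (\<lambda>z. c * f z)"

global_interpretation cfun: vector_space cscale
  by unfold_locales (auto simp: cscale_def fun_eq_iff algebra_simps)

text \<open>Holomorphy in several variables: a Frechet derivative that is complex linear at each point.\<close>

definition Hol :: "(complex ^ 'd) set \<Rightarrow> (complex ^ 'd \<Rightarrow> complex) set" where
  "Hol \<Omega> = {f. (\<forall>z\<in>\<Omega>. \<exists>L. (f has_derivative L) (at z) \<and> Vector_Spaces.linear (*s) (*) L) \<and>
               (\<forall>z. z \<notin> \<Omega> \<longrightarrow> f z = 0)}"

definition polys :: "(complex ^ 'd \<Rightarrow> complex) set" where
  "polys = {P. \<exists>(A :: ('d \<Rightarrow> nat) set) c. finite A \<and>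
               P = (\<lambda>z. \<Sum>\<alpha>\<in>A. c \<alpha> * (\<Prod>j\<in>UNIV. (z $ j) ^ \<alpha> j))}"

definition hausdorff_tvs :: "('a \<Rightarrow> complex) set \<Rightarrow> ('a \<Rightarrow> complex) topology \<Rightarrow> bool" where
  "hausdorff_tvs X T \<longleftrightarrow>
     cfun.subspace X \<and> topspace T = X \<and> Hausdorff_space T \<and>
     continuous_map (prod_topology T T) T (\<lambda>(f, g). f + g) \<and>
     continuous_map (prod_topology euclidean T) T (\<lambda>(c, f). cscale c f)"

definition prop_P1 :: "(complex ^ 'd) set \<Rightarrow> (complex ^ 'd \<Rightarrow> complex) set \<Rightarrow> (complex ^ 'd \<Rightarrow> complex) topology \<Rightarrow> bool" where
  "prop_P1 \<Omega> X T \<longleftrightarrow> restr \<Omega> ` polys \<subseteq> X \<and> T closure_of (restr \<Omega> ` polys) = X"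

definition prop_P2 :: "'a set \<Rightarrow> ('a \<Rightarrow> complex) topology \<Rightarrow> bool" where
  "prop_P2 \<Omega> T \<longleftrightarrow> (\<forall>w\<in>\<Omega>. continuous_map T euclidean (\<lambda>F. F w))"

definition shift :: "'d \<Rightarrow> (complex ^ 'd \<Rightarrow> complex) \<Rightarrow> complex ^ 'd \<Rightarrow> complex" where
  "shift j F = (\<lambda>z. z $ j * F z)"

definition prop_P3 :: "(complex ^ 'd \<Rightarrow> complex) set \<Rightarrow> (complex ^ 'd \<Rightarrow> complex) topology \<Rightarrow> bool" where
  "prop_P3 X T \<longleftrightarrow> (\<forall>j. shift j ` X \<subseteq> X \<and> continuous_map T T (shift j))"

text \<open>\<open>inv_gen T F\<close> is $S[F]$ and \<open>inv_gen_family T \<F>\<close> is $S[\mathcal{F}]$. As \<open>F\<close> vanishes off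
  \<open>\<Omega>\<close>, so does \<open>P * F\<close>, and \<open>P\<close> need not be restricted.\<close>

definition inv_gen :: "(complex ^ 'd \<Rightarrow> complex) topology \<Rightarrow> (complex ^ 'd \<Rightarrow> complex)
    \<Rightarrow> (complex ^ 'd \<Rightarrow> complex) set" where
  "inv_gen T F = T closure_of {P * F | P. P \<in> polys}"

definition inv_gen_family :: "(complex ^ 'd \<Rightarrow> complex) topology \<Rightarrow> (complex ^ 'd \<Rightarrow> complex) set
    \<Rightarrow> (complex ^ 'd \<Rightarrow> complex) set" where
  "inv_gen_family T \<F> = T closure_of (cfun.span (\<Union>F\<in>\<F>. inv_gen T F))"

definition jointly_cyclic :: "(complex ^ 'd \<Rightarrow> complex) set \<Rightarrow> (complex ^ 'd \<Rightarrow> complex) topology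
    \<Rightarrow> (complex ^ 'd \<Rightarrow> complex) set \<Rightarrow> bool" where
  "jointly_cyclic X T \<F> \<longleftrightarrow> inv_gen_family T \<F> = X"

definition coord_family :: "(complex ^ 'd) set \<Rightarrow> complex ^ 'd \<Rightarrow> (complex ^ 'd \<Rightarrow> complex) set" where
  "coord_family \<Omega> w = {restr \<Omega> (\<lambda>z. z $ j - w $ j) | j. True}"

definition constants :: "'a set \<Rightarrow> ('a \<Rightarrow> complex) set" where
  "constants \<Omega> = {restr \<Omega> (\<lambda>_. c) | c. True}"

definition continuous_linear_functional ::
  "('a \<Rightarrow> complex) set \<Rightarrow> ('a \<Rightarrow> complex) topology \<Rightarrow> (('a \<Rightarrow> complex) \<Rightarrow> complex) \<Rightarrow> bool" where
  "continuous_linear_functional X T \<phi> \<longleftrightarrow>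
     (\<forall>f\<in>X. \<forall>g\<in>X. \<phi> (f + g) = \<phi> f + \<phi> g) \<and>
     (\<forall>c. \<forall>f\<in>X. \<phi> (cscale c f) = c * \<phi> f) \<and>
     continuous_map T euclidean \<phi>"

definition max_domain :: "(complex ^ 'd) set \<Rightarrow> (complex ^ 'd \<Rightarrow> complex) set
    \<Rightarrow> (complex ^ 'd \<Rightarrow> complex) topology \<Rightarrow> (complex ^ 'd) set" where
  "max_domain \<Omega> X T =
     {w. \<exists>\<phi>. continuous_linear_functional X T \<phi> \<and> (\<forall>P\<in>polys. \<phi> (restr \<Omega> P) = P w)}"

definition direct_sum :: "('a \<Rightarrow> complex) set \<Rightarrow> ('a \<Rightarrow> complex) set \<Rightarrow> ('a \<Rightarrow> complex) set \<Rightarrow> bool" where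
  "direct_sum X A B \<longleftrightarrow>
     cfun.subspace A \<and> cfun.subspace B \<and> X = A + B \<and> A \<inter> B = {0}"

end

theory Submission
  imports Defs
begin

text \<open>Write \<open>M\<close> for \<open>S[\<F>\<^sub>w]\<close>. Every polynomial is congruent to its value at \<open>w\<close> modulo the
  ideal generated by the \<open>z\<^sub>j - w\<^sub>j\<close>, so the constants together with \<open>M\<close> are dense. Adding a line to
  a closed subspace gives a closed subspace, hence the sum is everything. Moreover a linear functional
  with kernel \<open>M\<close> is continuous because \<open>M\<close> is closed, and so evaluation at \<open>w\<close> extends continuously
  exactly when \<open>1\<close> is not in \<open>M\<close>.

  Both topological facts come from the neighbourhood \<open>{y. \<forall>s. \<bar>s\<bar> \<le> 1 \<longrightarrow> x - s y \<notin> M}\<close> of \<open>0\<close>,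
  on which the coefficient of \<open>x\<close> modulo \<open>M\<close> is less than \<open>1\<close> in modulus. It is open since projection
  along the compact unit disc is a closed map.\<close>

section \<open>Closed subspaces and lines\<close>

locale function_tvs =
  fixes X :: "('a \<Rightarrow> complex) set" and T :: "('a \<Rightarrow> complex) topology"
  assumes tvs: "hausdorff_tvs X T"
begin

lemma subspace_X: "cfun.subspace X"
  and topspace_eq [simp]: "topspace T = X"
  using tvs by (auto simp: hausdorff_tvs_def)

lemma continuous_map_add_fun:
  assumes "continuous_map S T f" "continuous_map S T g"
  shows "continuous_map S T (\<lambda>x. f x + g x)"
proof -
  have "continuous_map S T ((\<lambda>(f, g). f + g) \<circ> (\<lambda>x. (f x, g x)))"
    using tvs assms
    by (intro continuous_map_compose[of _ "prod_topology T T"])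
      (auto simp: hausdorff_tvs_def continuous_map_pairedI)
  then show ?thesis by (simp add: o_def)
qed

lemma continuous_map_cscale:
  assumes "continuous_map S euclidean c" "continuous_map S T f"
  shows "continuous_map S T (\<lambda>x. cscale (c x) (f x))"
proof -
  have "continuous_map S T ((\<lambda>(c, f). cscale c f) \<circ> (\<lambda>x. (c x, f x)))"
    using tvs assms
    by (intro continuous_map_compose[of _ "prod_topology euclidean T"])
      (auto simp: hausdorff_tvs_def continuous_map_pairedI)
  then show ?thesis by (simp add: o_def)
qed

lemma continuous_map_diff_fun:
  assumes "continuous_map S T f" "continuous_map S T g"
  shows "continuous_map S T (\<lambda>x. f x - g x)"
proof -
  have "continuous_map S T (\<lambda>x. f x + cscale (-1) (g x))"
    by (intro continuous_map_add_fun continuous_map_cscale assms) simp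
  then show ?thesis by (simp add: cscale_def fun_diff_def plus_fun_def)
qed

text \<open>Addition is jointly continuous and the closure of \<open>V \<times> V\<close> is the
  product of the closures, so sums of closure points are limits of sums from \<open>V\<close>;
  scaling by a fixed \<open>c\<close> is treated in the same way.\<close>

lemma subspace_closure_of:
  assumes "cfun.subspace V" "V \<subseteq> X"
  shows "cfun.subspace (T closure_of V)"
proof (rule cfun.subspaceI)
  show "0 \<in> T closure_of V"
    using assms closure_of_subset[of V T] cfun.subspace_0 by auto
next
  fix f g assume "f \<in> T closure_of V" "g \<in> T closure_of V"
  then have "(f, g) \<in> prod_topology T T closure_of (V \<times> V)"
    by (simp add: closure_of_Times)
  moreover have "continuous_map (prod_topology T T) T (\<lambda>p. fst p + snd p)"
    by (intro continuous_map_add_fun continuous_map_fst continuous_map_snd)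
  ultimately have "f + g \<in> T closure_of ((\<lambda>p. fst p + snd p) ` (V \<times> V))"
    using continuous_map_image_closure_subset by fastforce
  moreover have "(\<lambda>p. fst p + snd p) ` (V \<times> V) \<subseteq> V"
    using assms(1) by (auto intro: cfun.subspace_add)
  ultimately show "f + g \<in> T closure_of V"
    using closure_of_mono by blast
next
  fix c f assume f: "f \<in> T closure_of V"
  have "continuous_map T T (\<lambda>f. cscale c f)"
    using continuous_map_cscale[of T "\<lambda>_. c" "\<lambda>f. f"] continuous_map_id by (simp add: id_def)
  then have "cscale c f \<in> T closure_of (cscale c ` V)"
    using f continuous_map_image_closure_subset by fastforce
  moreover have "cscale c ` V \<subseteq> V"
    using assms(1) by (auto intro: cfun.subspace_scale)
  ultimately show "cscale c f \<in> T closure_of V"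
    using closure_of_mono by blast
qed

text \<open>The set is the projection to the first factor of a closed subset of
  \<open>X \<times> K\<close>, and this projection is a closed map because \<open>K\<close> is
  compact. It is applied with the unit disc and with a disc of radius \<open>1/e\<close>.\<close>

lemma closedin_exists_compact_scalar:
  assumes "closedin T M" "compact K"
    and "continuous_map (prod_topology T euclidean) T (\<lambda>p. h (fst p) (snd p))"
  shows "closedin T {y \<in> X. \<exists>s\<in>K. h y s \<in> M}"
proof -
  let ?K = "subtopology euclidean K"
  let ?P = "prod_topology T ?K"
  have "continuous_map ?P T (\<lambda>p. h (fst p) (snd p))"
    using continuous_map_from_subtopology[OF assms(3), of "X \<times> K"]
    by (simp add: prod_topology_subtopology)
  then have "closedin ?P {p \<in> topspace ?P. h (fst p) (snd p) \<in> M}"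
    using closedin_continuous_map_preimage assms(1) by blast
  moreover have "closed_map ?P T fst"
    using assms(2) by (intro closed_map_fst) (simp add: compact_space_subtopology)
  ultimately have "closedin T (fst ` {p \<in> topspace ?P. h (fst p) (snd p) \<in> M})"
    by (simp add: closed_map_def)
  moreover have "fst ` {p \<in> topspace ?P. h (fst p) (snd p) \<in> M} = {y \<in> X. \<exists>s\<in>K. h y s \<in> M}"
    by force
  ultimately show ?thesis by simp
qed

text \<open>This is the largest balanced \<open>U \<subseteq> X\<close> for which
  \<open>x - U\<close> misses \<open>M\<close>: letting \<open>s\<close> run over the whole closed
  disc builds balancedness into the definition.\<close>

definition separating_nbhd :: "('a \<Rightarrow> complex) set \<Rightarrow> ('a \<Rightarrow> complex) \<Rightarrow> ('a \<Rightarrow> complex) set" where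
  "separating_nbhd M x = {y \<in> X. \<forall>s\<in>cball 0 1. x - cscale s y \<notin> M}"

lemma openin_separating_nbhd:
  assumes "closedin T M" "x \<in> X"
  shows "openin T (separating_nbhd M x)"
proof -
  have "closedin T {y \<in> X. \<exists>s\<in>cball 0 1. x - cscale s y \<in> M}"
    using assms
    by (intro closedin_exists_compact_scalar continuous_map_diff_fun continuous_map_cscale
        continuous_map_fst continuous_map_snd) auto
  then have "openin T (X - {y \<in> X. \<exists>s\<in>cball 0 1. x - cscale s y \<in> M})"
    unfolding closedin_def topspace_eq by (rule conjunct2)
  also have "X - {y \<in> X. \<exists>s\<in>cball 0 1. x - cscale s y \<in> M} = separating_nbhd M x"
    by (auto simp: separating_nbhd_def)
  finally show ?thesis .
qed

lemma zero_in_separating_nbhd: "x \<notin> M \<Longrightarrow> 0 \<in> separating_nbhd M x"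
  using cfun.subspace_0[OF subspace_X] by (simp add: separating_nbhd_def)

text \<open>If \<open>norm c \<ge> 1\<close>, then \<open>s = inverse c\<close> lies in the unit
  disc, and rescaling \<open>y - c x\<close> by \<open>-s\<close> puts \<open>x - s y\<close> into
  \<open>M\<close>, which the neighbourhood excludes.\<close>

lemma coefficient_lt_1:
  assumes "cfun.subspace M" "y \<in> separating_nbhd M x" "y - cscale c x \<in> M"
  shows "norm c < 1"
proof (rule ccontr)
  assume "\<not> norm c < 1"
  then have c: "c \<noteq> 0" "inverse c \<in> cball 0 1"
    by (auto simp: norm_inverse intro: inverse_le_1_iff[THEN iffD2])
  have "cscale (- inverse c) (y - cscale c x) \<in> M"
    using assms by (intro cfun.subspace_scale)
  also have "cscale (- inverse c) (y - cscale c x) = x - cscale (inverse c) y"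
    using c by (auto simp: cscale_def fun_eq_iff field_simps)
  finally show False
    using assms(2) c unfolding separating_nbhd_def by blast
qed

text \<open>Around each closure point \<open>y\<close> there is an open set on which the
  coefficients \<open>c\<close> are bounded. There the sum lies in the set \<open>C\<close> with
  coefficients restricted to a compact disc, and \<open>C\<close> is closed.\<close>

lemma closedin_add_line:
  assumes M: "cfun.subspace M" "closedin T M" and x: "x \<in> X"
  shows "closedin T {y \<in> X. \<exists>c. y - cscale c x \<in> M}" (is "closedin T ?L")
proof (cases "x \<in> M")
  \<comment> \<open>The line already lies in \<open>M\<close>, so the sum is \<open>M\<close>
    itself. The other case has \<open>x \<notin> M\<close>, which places \<open>0\<close> in the
    separating neighbourhood.\<close>
  case True
  have "y \<in> M" if "y - cscale c x \<in> M" for y c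
    using cfun.subspace_add[OF M(1) that cfun.subspace_scale[OF M(1) True, of c]] by simp
  moreover have "y - cscale 0 x \<in> M" if "y \<in> M" for y
    using that by simp
  ultimately have "?L = M"
    using closedin_subset[OF M(2)] unfolding topspace_eq by blast
  then show ?thesis using M by simp
next
  case False
  let ?U = "separating_nbhd M x"
  have "T closure_of ?L \<subseteq> ?L"
  proof
    fix y assume y: "y \<in> T closure_of ?L"
    then have yX: "y \<in> X" using closure_of_subset_topspace[of T ?L] by auto
    \<comment> \<open>Since \<open>t y\<close> tends to \<open>0\<close> with \<open>t\<close>, the
      open set \<open>?U\<close> absorbs \<open>y\<close>; this supplies a radius \<open>e\<close>
      with \<open>e y \<in> ?U\<close>, so that the dilate \<open>V\<close> of \<open>?U\<close>
      contains \<open>y\<close>.\<close>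
    have "continuous_map euclidean T (\<lambda>t::complex. cscale t y)"
      using yX by (intro continuous_map_cscale) auto
    then have "open {t. cscale t y \<in> ?U}"
      using openin_continuous_map_preimage openin_separating_nbhd[OF M(2) x] by fastforce
    moreover have "(0::complex) \<in> {t. cscale t y \<in> ?U}"
      using zero_in_separating_nbhd[OF False] by simp
    ultimately obtain e where e: "e > 0" "cball (0::complex) e \<subseteq> {t. cscale t y \<in> ?U}"
      using open_contains_cball by metis
    let ?e = "complex_of_real e"
    define V where "V = {z \<in> X. cscale ?e z \<in> ?U}"
    have "continuous_map T T (\<lambda>z. cscale ?e z)"
      using continuous_map_cscale[of T "\<lambda>_. ?e" "\<lambda>f. f"] continuous_map_id by (simp add: id_def)
    then have V: "openin T V"
      using openin_continuous_map_preimage openin_separating_nbhd[OF M(2) x]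
      unfolding V_def by fastforce
    have "?e \<in> cball 0 e" using e by simp
    then have yV: "y \<in> V" using e yX unfolding V_def by blast
    define C where "C = {z \<in> X. \<exists>c\<in>cball 0 (1/e). z - cscale c x \<in> M}"
    have "closedin T C"
      unfolding C_def using M x
      by (intro closedin_exists_compact_scalar continuous_map_diff_fun continuous_map_cscale
          continuous_map_fst continuous_map_snd) auto
    moreover have "V \<inter> ?L \<subseteq> C"
    proof
      fix z assume z: "z \<in> V \<inter> ?L"
      then obtain c where c: "z - cscale c x \<in> M" by auto
      \<comment> \<open>After scaling by \<open>e\<close> the point lies in \<open>?U\<close> and
        has coefficient \<open>e c\<close>, so \<open>norm (e c) < 1\<close>; this is where the
        radius \<open>1/e\<close> of the disc in \<open>C\<close> comes from.\<close>
      have "cscale ?e z - cscale (?e * c) x = cscale ?e (z - cscale c x)"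
        by (auto simp: cscale_def fun_eq_iff algebra_simps)
      also have "\<dots> \<in> M" using M c by (intro cfun.subspace_scale)
      finally have "norm (?e * c) < 1"
        using z M by (intro coefficient_lt_1[of M "cscale ?e z" x]) (auto simp: V_def)
      then have "norm c \<le> 1 / e" using e by (simp add: norm_mult field_simps)
      then show "z \<in> C" using z c by (auto simp: C_def)
    qed
    \<comment> \<open>As \<open>V\<close> is an open neighbourhood of \<open>y\<close>, intersecting
      \<open>?L\<close> with it keeps \<open>y\<close> in the closure.\<close>
    moreover have "y \<in> T closure_of (V \<inter> ?L)"
      using openin_Int_closure_of_subset[OF V] y yV by blast
    ultimately have "y \<in> C"
      using closure_of_minimal by blast
    then show "y \<in> ?L" by (auto simp: C_def)
  qed
  moreover have "?L \<subseteq> topspace T" by auto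
  ultimately show ?thesis
    using closure_of_subset_eq by blast
qed

text \<open>By translation, the bound near \<open>0\<close> gives continuity at every
  \<open>y\<close>: on \<open>y + e U\<close>, with \<open>U\<close> the separating neighbourhood,
  \<open>\<phi>\<close> differs from \<open>\<phi> y\<close> by less than \<open>e\<close>.\<close>

lemma continuous_map_coefficient:
  assumes M: "cfun.subspace M" "closedin T M" and x: "x \<in> X" "x \<notin> M"
    and \<phi>: "\<And>y. y \<in> X \<Longrightarrow> y - cscale (\<phi> y) x \<in> M"
  shows "continuous_map T euclidean \<phi>"
  unfolding continuous_map
proof (intro conjI allI impI)
  fix S :: "complex set" assume S: "openin euclidean S"
  show "openin T {y \<in> topspace T. \<phi> y \<in> S}"
  proof (subst openin_subopen, intro ballI)
    fix y assume "y \<in> {y \<in> topspace T. \<phi> y \<in> S}"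
    then have y: "y \<in> X" "\<phi> y \<in> S" by auto
    then obtain e where e: "e > 0" "ball (\<phi> y) e \<subseteq> S"
      using S open_contains_ball by (metis open_openin)
    \<comment> \<open>The factor is the reciprocal of the radius, so that a scaled coefficient below
      \<open>1\<close> means a distance below \<open>e\<close>.\<close>
    let ?e = "complex_of_real (1 / e)"
    define V where "V = {z \<in> X. cscale ?e (z - y) \<in> separating_nbhd M x}"
    have "continuous_map T T (\<lambda>z. cscale ?e (z - y))"
      using y continuous_map_id[of T]
      by (intro continuous_map_cscale continuous_map_diff_fun) (auto simp: id_def)
    then have V: "openin T V"
      using openin_continuous_map_preimage openin_separating_nbhd[OF M(2) x(1)]
      unfolding V_def by fastforce
    have yV: "y \<in> V" using y zero_in_separating_nbhd[OF x(2)] by (simp add: V_def)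
    have "\<phi> z \<in> S" if z: "z \<in> V" for z
    proof -
      \<comment> \<open>\<open>coefficient_lt_1\<close> accepts any coefficient modulo
        \<open>M\<close>, so subtracting the memberships for \<open>z\<close> and \<open>y\<close>
        suffices to make \<open>\<phi> z - \<phi> y\<close> a coefficient of
        \<open>z - y\<close>.\<close>
      have "cscale ?e (z - y) - cscale (?e * (\<phi> z - \<phi> y)) x
          = cscale ?e ((z - cscale (\<phi> z) x) - (y - cscale (\<phi> y) x))"
        by (auto simp: cscale_def fun_eq_iff algebra_simps)
      also have "\<dots> \<in> M"
        using M y z by (intro cfun.subspace_scale cfun.subspace_diff \<phi>) (auto simp: V_def)
      finally have "norm (?e * (\<phi> z - \<phi> y)) < 1"
        using z M by (intro coefficient_lt_1[of M "cscale ?e (z - y)" x]) (auto simp: V_def)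
      then have "dist (\<phi> y) (\<phi> z) < e"
        using e by (simp add: norm_mult norm_divide field_simps dist_norm norm_minus_commute)
      then show ?thesis using e by auto
    qed
    then show "\<exists>U. openin T U \<and> y \<in> U \<and> U \<subseteq> {y \<in> topspace T. \<phi> y \<in> S}"
      using V yV by (intro exI[of _ V]) (auto simp: V_def)
  qed
qed auto

end

section \<open>Polynomials modulo the ideal of a point\<close>

definition mon :: "('d \<Rightarrow> nat) \<Rightarrow> complex ^ 'd \<Rightarrow> complex" where
  "mon \<alpha> = (\<lambda>z. \<Prod>j\<in>UNIV. (z $ j) ^ \<alpha> j)"

lemma mon_0: "mon (\<lambda>_. 0) = (\<lambda>_. 1)"
  by (simp add: mon_def)

lemma mon_Suc:
  fixes \<alpha> :: "'d::finite \<Rightarrow> nat"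
  shows "mon (\<alpha>(j := Suc (\<alpha> j))) = (\<lambda>z. mon \<alpha> z * z $ j)"
proof
  fix z :: "complex ^ 'd"
  have "(\<Prod>i\<in>UNIV - {j}. z $ i ^ (\<alpha>(j := Suc (\<alpha> j))) i) = (\<Prod>i\<in>UNIV - {j}. z $ i ^ \<alpha> i)"
    by (intro prod.cong) auto
  then show "mon (\<alpha>(j := Suc (\<alpha> j))) z = mon \<alpha> z * z $ j"
    by (simp add: mon_def prod.remove[of UNIV j])
qed

lemma sum_fun_apply: "(\<Sum>a\<in>A. f a) x = (\<Sum>a\<in>A. f a x)"
  by (induction A rule: infinite_finite_induct) auto

text \<open>In this form a property of polynomials that defines a subspace has to be checked on
  monomials only.\<close>

lemma polys_eq_span: "polys = cfun.span (range mon)"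
proof
  show "polys \<subseteq> cfun.span (range mon)"
  proof
    fix P :: "complex ^ 'd \<Rightarrow> complex" assume "P \<in> polys"
    then obtain A c where "P = (\<lambda>z. \<Sum>\<alpha>\<in>A. c \<alpha> * mon \<alpha> z)"
      by (auto simp: polys_def mon_def)
    then have "P = (\<Sum>\<alpha>\<in>A. cscale (c \<alpha>) (mon \<alpha>))"
      by (simp add: cscale_def fun_eq_iff sum_fun_apply)
    then show "P \<in> cfun.span (range mon)"
      by (simp add: cfun.span_sum cfun.span_scale cfun.span_base)
  qed
  show "cfun.span (range mon) \<subseteq> polys"
  proof
    fix P :: "complex ^ 'd \<Rightarrow> complex" assume "P \<in> cfun.span (range mon)"
    then obtain t r where t: "finite t" "t \<subseteq> range mon" and P: "P = (\<Sum>a\<in>t. cscale (r a) a)"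
      by (auto simp: cfun.span_explicit)
    \<comment> \<open>One exponent is chosen for each member of \<open>t\<close>, which makes the
      sum over \<open>t\<close> a sum over \<open>A\<close> by reindexing.\<close>
    obtain A :: "('d \<Rightarrow> nat) set" where A: "inj_on mon A" "t = mon ` A"
      using t(2) by (auto simp: subset_image_inj)
    then have "finite A" using t(1) finite_imageD by blast
    moreover have "P = (\<lambda>z. \<Sum>\<alpha>\<in>A. r (mon \<alpha>) * mon \<alpha> z)"
      using A P by (simp add: sum.reindex cscale_def fun_eq_iff sum_fun_apply)
    ultimately show "P \<in> polys"
      unfolding polys_def mon_def mem_Collect_eq
      by (intro exI[of _ A] exI[of _ "\<lambda>\<alpha>. r (\<lambda>z. \<Prod>j\<in>UNIV. z $ j ^ \<alpha> j)"]) simp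
  qed
qed

lemma subspace_polys: "cfun.subspace polys"
  by (simp add: polys_eq_span)

lemma mon_in_polys: "mon \<alpha> \<in> polys"
  by (simp add: polys_eq_span cfun.span_base)

lemma const_in_polys: "(\<lambda>_. c) \<in> polys"
proof -
  have "(\<lambda>_. c) = cscale c (mon (\<lambda>_. 0))" by (simp add: mon_0 cscale_def)
  then show ?thesis
    by (metis cfun.subspace_scale mon_in_polys subspace_polys)
qed

text \<open>The admissible \<open>P\<close> form a subspace, and for a monomial the product is a
  difference of a monomial of higher degree and a multiple of the given one.\<close>

lemma polys_mult_coord:
  assumes "P \<in> polys"
  shows "(\<lambda>z. P z * (z $ j - a)) \<in> polys"
proof -
  have "cfun.subspace {P. (\<lambda>z. P z * (z $ j - a)) \<in> polys}"
  proof (rule cfun.subspaceI, goal_cases)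
    case 1
    show ?case using const_in_polys[of 0] by simp
  next
    case (2 P Q)
    then show ?case
      using cfun.subspace_add[OF subspace_polys, of "\<lambda>z. P z * (z $ j - a)" "\<lambda>z. Q z * (z $ j - a)"]
      by (simp add: plus_fun_def distrib_right)
  next
    case (3 c P)
    then show ?case
      using cfun.subspace_scale[OF subspace_polys, of "\<lambda>z. P z * (z $ j - a)" c]
      by (simp add: cscale_def mult.assoc)
  qed
  moreover have "(\<lambda>z. mon \<alpha> z * (z $ j - a)) \<in> polys" for \<alpha>
  proof -
    have "(\<lambda>z. mon \<alpha> z * (z $ j - a)) = mon (\<alpha>(j := Suc (\<alpha> j))) - cscale a (mon \<alpha>)"
      unfolding mon_Suc by (auto simp: cscale_def fun_eq_iff algebra_simps)
    then show ?thesis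
      by (metis cfun.subspace_diff cfun.subspace_scale mon_in_polys subspace_polys)
  qed
  ultimately show ?thesis
    using assms cfun.span_minimal[of "range mon" "{P. (\<lambda>z. P z * (z $ j - a)) \<in> polys}"]
    unfolding polys_eq_span by blast
qed

lemma mult_restr_coord: "P * restr \<Omega> (\<lambda>z. z $ j - a) = restr \<Omega> (\<lambda>z. P z * (z $ j - a))"
  by (auto simp: restr_def fun_eq_iff)

text \<open>The maximal ideal of the polynomial ring at \<open>w\<close>, restricted to
  \<open>\<Omega>\<close>; it is purely algebraic, with no closure taken.\<close>

definition point_ideal :: "(complex ^ 'd) set \<Rightarrow> complex ^ 'd \<Rightarrow> (complex ^ 'd \<Rightarrow> complex) set" where
  "point_ideal \<Omega> w = cfun.span {P * F | P F. P \<in> polys \<and> F \<in> coord_family \<Omega> w}"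

text \<open>Induction on the total degree: if \<open>mon \<alpha>\<close> is \<open>z $ j\<close>
  times \<open>mon \<beta>\<close>, then \<open>mon \<alpha> z - mon \<alpha> w\<close> equals
  \<open>mon \<beta> z * (z $ j - w $ j) + w $ j * (mon \<beta> z - mon \<beta> w)\<close>.\<close>

lemma mon_mod_point_ideal:
  "restr \<Omega> (mon \<alpha>) - cscale (mon \<alpha> w) (restr \<Omega> (\<lambda>_. 1)) \<in> point_ideal \<Omega> w"
proof (induction "\<Sum>j\<in>UNIV. \<alpha> j" arbitrary: \<alpha>)
  case 0
  then have "\<alpha> = (\<lambda>_. 0)" by (auto simp: fun_eq_iff)
  then have "restr \<Omega> (mon \<alpha>) - cscale (mon \<alpha> w) (restr \<Omega> (\<lambda>_. 1)) = 0"
    by (simp add: mon_0)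
  then show ?case
    by (simp only: point_ideal_def cfun.span_zero)
next
  case (Suc n)
  then obtain j where j: "\<alpha> j \<noteq> 0"
    by (metis (no_types, lifting) nat.distinct(1) sum.neutral)
  \<comment> \<open>Subtraction of naturals is truncated; \<open>\<alpha> j \<noteq> 0\<close>
    guarantees that the degree drops by exactly one.\<close>
  define \<beta> where "\<beta> = \<alpha>(j := \<alpha> j - 1)"
  have \<alpha>: "\<alpha> = \<beta>(j := Suc (\<beta> j))" using j by (simp add: \<beta>_def)
  have "(\<Sum>i\<in>UNIV. \<alpha> i) = Suc (\<Sum>i\<in>UNIV. \<beta> i)"
    using j by (simp add: \<beta>_def sum.remove[of UNIV j])
  then have IH: "restr \<Omega> (mon \<beta>) - cscale (mon \<beta> w) (restr \<Omega> (\<lambda>_. 1)) \<in> point_ideal \<Omega> w"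
    using Suc by simp
  have gen: "mon \<beta> * restr \<Omega> (\<lambda>z. z $ j - w $ j) \<in> point_ideal \<Omega> w"
    unfolding point_ideal_def coord_family_def using mon_in_polys
    by (intro cfun.span_base) blast
  have "restr \<Omega> (mon \<alpha>) - cscale (mon \<alpha> w) (restr \<Omega> (\<lambda>_. 1)) =
      mon \<beta> * restr \<Omega> (\<lambda>z. z $ j - w $ j) +
      cscale (w $ j) (restr \<Omega> (mon \<beta>) - cscale (mon \<beta> w) (restr \<Omega> (\<lambda>_. 1)))"
    by (subst (1 2) \<alpha>, unfold mon_Suc) (auto simp: restr_def cscale_def fun_eq_iff algebra_simps)
  then show ?case
    using IH gen by (simp add: point_ideal_def cfun.span_add cfun.span_scale)
qed

text \<open>The remainder \<open>?r P\<close> is linear in \<open>P\<close>, so the case of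
  monomials carries over to their span.\<close>

lemma poly_mod_point_ideal:
  assumes "P \<in> polys"
  shows "restr \<Omega> P - cscale (P w) (restr \<Omega> (\<lambda>_. 1)) \<in> point_ideal \<Omega> w"
proof -
  let ?r = "\<lambda>P. restr \<Omega> P - cscale (P w) (restr \<Omega> (\<lambda>_. 1))"
  have sub: "cfun.subspace (point_ideal \<Omega> w)" by (simp add: point_ideal_def)
  have add: "?r (P + Q) = ?r P + ?r Q" and scale: "?r (cscale c P) = cscale c (?r P)" for P Q c
    by (auto simp: restr_def cscale_def fun_eq_iff algebra_simps)
  have "?r 0 = 0" by (auto simp: restr_def cscale_def fun_eq_iff)
  then have "cfun.subspace {P. ?r P \<in> point_ideal \<Omega> w}"
    using sub
    by (intro cfun.subspaceI)
      (simp_all only: mem_Collect_eq add scale cfun.subspace_0 cfun.subspace_add cfun.subspace_scale)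
  then show ?thesis
    using assms mon_mod_point_ideal
      cfun.span_minimal[of "range mon" "{P. ?r P \<in> point_ideal \<Omega> w}"]
    unfolding polys_eq_span by blast
qed

section \<open>The decomposition\<close>

locale poly_dense_tvs = function_tvs X T
  for X :: "(complex ^ 'd \<Rightarrow> complex) set" and T :: "(complex ^ 'd \<Rightarrow> complex) topology" +
  fixes \<Omega> :: "(complex ^ 'd) set"
  assumes P1: "prop_P1 \<Omega> X T"
begin

abbreviation "M w \<equiv> inv_gen_family T (coord_family \<Omega> w)"
abbreviation "unit \<equiv> restr \<Omega> (\<lambda>_. 1)"

lemma restr_poly_in_X: "P \<in> polys \<Longrightarrow> restr \<Omega> P \<in> X"
  using P1 by (auto simp: prop_P1_def)

lemma unit_in_X: "unit \<in> X"
  by (intro restr_poly_in_X const_in_polys)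

lemma constants_eq: "constants \<Omega> = range (\<lambda>c. cscale c unit)"
proof -
  have "constants \<Omega> = range (\<lambda>c. restr \<Omega> (\<lambda>_. c))"
    by (auto simp: constants_def)
  also have "(\<lambda>c. restr \<Omega> (\<lambda>_. c)) = (\<lambda>c. cscale c unit)"
    by (auto simp: restr_def cscale_def fun_eq_iff)
  finally show ?thesis .
qed

lemma generators_in_X:
  "F \<in> coord_family \<Omega> w \<Longrightarrow> {P * F | P. P \<in> polys} \<subseteq> X"
  by (auto simp: coord_family_def mult_restr_coord intro!: restr_poly_in_X polys_mult_coord)

lemma span_inv_gen_in_X: "cfun.span (\<Union>F\<in>coord_family \<Omega> w. inv_gen T F) \<subseteq> X"
  using closure_of_subset_topspace[of T]
  by (intro cfun.span_minimal subspace_X) (auto simp: inv_gen_def)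

lemma subspace_M: "cfun.subspace (M w)"
  unfolding inv_gen_family_def by (intro subspace_closure_of span_inv_gen_in_X cfun.subspace_span)

lemma closedin_M: "closedin T (M w)"
  by (simp add: inv_gen_family_def)

lemma M_subset_X: "M w \<subseteq> X"
  using closedin_subset[OF closedin_M] by simp

lemma point_ideal_subset_M: "point_ideal \<Omega> w \<subseteq> M w"
proof -
  have "P * F \<in> M w" if "P \<in> polys" "F \<in> coord_family \<Omega> w" for P F
  proof -
    have "P * F \<in> inv_gen T F"
      unfolding inv_gen_def using closure_of_subset[of "{P * F | P. P \<in> polys}" T]
        generators_in_X[OF that(2)] that(1) by auto
    then have "P * F \<in> cfun.span (\<Union>F\<in>coord_family \<Omega> w. inv_gen T F)"
      using that(2) by (intro cfun.span_base) blast
    then show ?thesis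
      unfolding inv_gen_family_def using closure_of_subset span_inv_gen_in_X
      by (metis in_mono topspace_eq)
  qed
  then show ?thesis
    unfolding point_ideal_def by (intro cfun.span_minimal subspace_M) auto
qed

text \<open>\<open>S[F]\<close>, the span and the final closure each stay inside \<open>N\<close>,
  because \<open>N\<close> is both closed and a subspace.\<close>

lemma M_minimal:
  assumes "closedin T N" "cfun.subspace N" "\<And>P F. P \<in> polys \<Longrightarrow> F \<in> coord_family \<Omega> w \<Longrightarrow> P * F \<in> N"
  shows "M w \<subseteq> N"
  unfolding inv_gen_family_def inv_gen_def
  using assms by (intro closure_of_minimal cfun.span_minimal UN_least) auto

text \<open>The sum is closed by \<open>closedin_add_line\<close> and contains all restricted
  polynomials, which are dense in \<open>X\<close> by P1.\<close>

lemma constants_plus_M: "X = constants \<Omega> + M w"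
proof
  have "X = T closure_of (restr \<Omega> ` polys)"
    using P1 by (simp add: prop_P1_def)
  also have "\<dots> \<subseteq> {y \<in> X. \<exists>c. y - cscale c unit \<in> M w}"
    using poly_mod_point_ideal point_ideal_subset_M restr_poly_in_X
    by (intro closure_of_minimal closedin_add_line subspace_M closedin_M unit_in_X) blast
  finally have *: "X \<subseteq> {y \<in> X. \<exists>c. y - cscale c unit \<in> M w}" .
  show "X \<subseteq> constants \<Omega> + M w"
  proof
    fix y assume "y \<in> X"
    then obtain c where "y - cscale c unit \<in> M w" using * by blast
    then have "cscale c unit + (y - cscale c unit) \<in> constants \<Omega> + M w"
      by (intro set_plus_intro) (auto simp: constants_eq)
    then show "y \<in> constants \<Omega> + M w" by simp
  qed
  show "constants \<Omega> + M w \<subseteq> X"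
    unfolding constants_eq set_plus_def using M_subset_X unit_in_X
    by (auto intro!: cfun.subspace_add[OF subspace_X] cfun.subspace_scale[OF subspace_X])
qed

text \<open>Once \<open>unit\<close> lies in \<open>M w\<close>, so do all constants, and the
  decomposition collapses to \<open>X = M w\<close>.\<close>

lemma jointly_cyclic_iff: "jointly_cyclic X T (coord_family \<Omega> w) \<longleftrightarrow> unit \<in> M w"
proof
  assume "unit \<in> M w"
  then have "constants \<Omega> + M w \<subseteq> M w"
    unfolding constants_eq set_plus_def
    by (auto intro!: cfun.subspace_add[OF subspace_M] cfun.subspace_scale[OF subspace_M])
  then show "jointly_cyclic X T (coord_family \<Omega> w)"
    using constants_plus_M[of w] M_subset_X[of w] by (auto simp: jointly_cyclic_def)
qed (use unit_in_X in \<open>simp add: jointly_cyclic_def\<close>)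

lemma direct_sum_iff:
  assumes "\<Omega> \<noteq> {}"
  shows "direct_sum X (constants \<Omega>) (M w) \<longleftrightarrow> unit \<notin> M w"
proof
  assume "direct_sum X (constants \<Omega>) (M w)"
  moreover have "unit \<in> constants \<Omega>" by (auto simp: constants_def)
  \<comment> \<open>On an empty \<open>\<Omega>\<close> the function \<open>unit\<close> would be
    \<open>0\<close> and hence a member of \<open>M w\<close>.\<close>
  moreover have "unit \<noteq> 0" using assms by (auto simp: restr_def fun_eq_iff)
  ultimately show "unit \<notin> M w" by (auto simp: direct_sum_def)
next
  assume unit: "unit \<notin> M w"
  have "c = 0" if "cscale c unit \<in> M w" for c
  proof (rule ccontr)
    assume "c \<noteq> 0"
    then show False
      using cfun.subspace_scale[OF subspace_M that, of "inverse c"] unit by simp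
  qed
  then have "constants \<Omega> \<inter> M w = {0}"
    unfolding constants_eq using cfun.subspace_0[OF subspace_M]
    by (auto intro!: image_eqI[of _ _ 0])
  moreover have "cfun.subspace (constants \<Omega>)"
    unfolding constants_eq by (metis cfun.span_singleton cfun.subspace_span)
  ultimately show "direct_sum X (constants \<Omega>) (M w)"
    using subspace_M constants_plus_M by (simp add: direct_sum_def)
qed

text \<open>The kernel \<open>N\<close> of the extended evaluation is a closed subspace containing
  every \<open>P * F\<close>, as \<open>P z * (z $ j - w $ j)\<close> vanishes at \<open>w\<close>.
  So \<open>M w\<close> lies in the kernel, whereas \<open>unit\<close> is sent to
  \<open>1\<close>.\<close>

lemma unit_notin_M_if_max_domain:
  assumes "w \<in> max_domain \<Omega> X T"
  shows "unit \<notin> M w"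
proof -
  obtain \<phi> where \<phi>: "continuous_linear_functional X T \<phi>"
    and ev: "\<And>P. P \<in> polys \<Longrightarrow> \<phi> (restr \<Omega> P) = P w"
    using assms by (auto simp: max_domain_def)
  define N where "N = {f \<in> X. \<phi> f \<in> {0}}"
  have "closedin T {f \<in> topspace T. \<phi> f \<in> {0}}"
    using \<phi> by (intro closedin_continuous_map_preimage[of _ euclidean])
      (auto simp: continuous_linear_functional_def)
  then have "closedin T N" by (simp add: N_def)
  moreover have "\<phi> 0 = 0"
    using \<phi> cfun.subspace_0[OF subspace_X] cfun.scale_zero_left[of 0]
    unfolding continuous_linear_functional_def by (metis mult_zero_left)
  then have "cfun.subspace N"
    using \<phi> subspace_X
    by (auto simp: N_def continuous_linear_functional_def cfun.subspace_def)
  moreover have "P * F \<in> N" if "P \<in> polys" "F \<in> coord_family \<Omega> w" for P F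
    using that
    by (auto simp: N_def coord_family_def mult_restr_coord polys_mult_coord restr_poly_in_X ev)
  ultimately have "M w \<subseteq> N" by (intro M_minimal)
  moreover have "\<phi> unit = 1" by (intro ev const_in_polys)
  ultimately show ?thesis by (auto simp: N_def)
qed

text \<open>The functional sends \<open>y\<close> to its coefficient of \<open>unit\<close> modulo
  \<open>M w\<close>. The decomposition gives existence of this coefficient; its uniqueness yields
  linearity and the values on polynomials.\<close>

lemma max_domain_if_unit_notin_M:
  assumes unit: "unit \<notin> M w"
  shows "w \<in> max_domain \<Omega> X T"
proof -
  have uniq: "c = c'" if "y - cscale c unit \<in> M w" "y - cscale c' unit \<in> M w" for y c c'
  proof (rule ccontr)
    assume "c \<noteq> c'"
    \<comment> \<open>The two remainders differ by \<open>(c' - c)\<close> times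
      \<open>unit\<close>, so rescaling would put \<open>unit\<close> into
      \<open>M w\<close>.\<close>
    then have "unit = cscale (inverse (c' - c)) ((y - cscale c unit) - (y - cscale c' unit))"
      by (auto simp: cscale_def fun_eq_iff field_simps)
    then show False
      using unit cfun.subspace_scale[OF subspace_M cfun.subspace_diff[OF subspace_M that]] by metis
  qed
  have "\<exists>c. y - cscale c unit \<in> M w" if "y \<in> X" for y
  proof -
    have "y \<in> constants \<Omega> + M w" using that constants_plus_M[of w] by blast
    then obtain a b where "y = a + b" "a \<in> constants \<Omega>" "b \<in> M w"
      by (rule set_plus_elim)
    then obtain c where "y = cscale c unit + b" unfolding constants_eq by blast
    then have "y - cscale c unit = b" by simp
    then show ?thesis using \<open>b \<in> M w\<close> by blast
  qed
  then obtain \<phi> where \<phi>: "\<And>y. y \<in> X \<Longrightarrow> y - cscale (\<phi> y) unit \<in> M w"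
    by metis
  have "\<phi> (f + g) = \<phi> f + \<phi> g" if "f \<in> X" "g \<in> X" for f g
  proof (rule uniq)
    show "f + g - cscale (\<phi> (f + g)) unit \<in> M w"
      using that by (intro \<phi> cfun.subspace_add[OF subspace_X])
    show "f + g - cscale (\<phi> f + \<phi> g) unit \<in> M w"
      using cfun.subspace_add[OF subspace_M \<phi>[OF that(1)] \<phi>[OF that(2)]]
      by (simp add: cfun.scale_left_distrib algebra_simps)
  qed
  moreover have "\<phi> (cscale c f) = c * \<phi> f" if "f \<in> X" for c f
  proof (rule uniq)
    show "cscale c f - cscale (\<phi> (cscale c f)) unit \<in> M w"
      using that by (intro \<phi> cfun.subspace_scale[OF subspace_X])
    show "cscale c f - cscale (c * \<phi> f) unit \<in> M w"
      using cfun.subspace_scale[OF subspace_M \<phi>[OF that], of c]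
      by (simp add: cfun.scale_right_diff_distrib)
  qed
  moreover have "continuous_map T euclidean \<phi>"
    using \<phi> unit unit_in_X by (intro continuous_map_coefficient[OF subspace_M closedin_M])
  ultimately have "continuous_linear_functional X T \<phi>"
    by (simp add: continuous_linear_functional_def)
  \<comment> \<open>By \<open>poly_mod_point_ideal\<close>, \<open>P w\<close> is also a coefficient
    of the restricted \<open>P\<close>, and uniqueness identifies it with the value of
    \<open>\<phi>\<close>.\<close>
  moreover have "\<phi> (restr \<Omega> P) = P w" if "P \<in> polys" for P
    using that poly_mod_point_ideal point_ideal_subset_M restr_poly_in_X
    by (intro uniq[of "restr \<Omega> P"] \<phi>) blast+
  ultimately show ?thesis by (auto simp: max_domain_def)
qed

end

theorem theorem3p1:
  fixes \<Omega> :: "(complex ^ 'd) set"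
    and X :: "(complex ^ 'd \<Rightarrow> complex) set"
    and T :: "(complex ^ 'd \<Rightarrow> complex) topology"
  assumes "open \<Omega>" and "\<Omega> \<noteq> {}"
    and "X \<subseteq> Hol \<Omega>"
    and "hausdorff_tvs X T"
    and "prop_P1 \<Omega> X T" and "prop_P2 \<Omega> T" and "prop_P3 X T"
  shows "(\<forall>w. X = constants \<Omega> + inv_gen_family T (coord_family \<Omega> w)) \<and>
    (\<forall>w. (w \<in> max_domain \<Omega> X T \<longleftrightarrow> \<not> jointly_cyclic X T (coord_family \<Omega> w)) \<and>
         (\<not> jointly_cyclic X T (coord_family \<Omega> w) \<longleftrightarrow>
            direct_sum X (constants \<Omega>) (inv_gen_family T (coord_family \<Omega> w))))"
proof -
  interpret poly_dense_tvs X T \<Omega>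
    using assms by unfold_locales
  \<comment> \<open>Each of the three conditions amounts to
    \<open>unit \<notin> M w\<close>.\<close>
  show ?thesis
    using constants_plus_M jointly_cyclic_iff direct_sum_iff[OF assms(2)]
      unit_notin_M_if_max_domain max_domain_if_unit_notin_M by blast
qed

end
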